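(* Let $\mathcal{N}\in\mathcal{S}_{ne}$. Suppose the following sum-of-squares program is feasible: there exist polynomials $s_p(\mathbf{x},\mathbf{y})$, $r_p(\mathbf{x},\mathbf{y})$ and vectors of polynomials $\mathbf{q}_p(\mathbf{x},\mathbf{y})$ (with $n_u$ entries) for all $p\in\mathcal{N}$, and polynomials $s_{p'}(\mathbf{x},\mathbf{y})$ for all $p'\in\mathcal{P}\setminus\mathcal{N}$, such that $$-1-\sum_{p\in\mathcal{N}}s_p(\mathbf{x},\mathbf{y})h_p(\mathbf{x})+\sum_{p'\in\mathcal{P}\setminus\mathcal{N}}s_{p'}(\mathbf{x},\mathbf{y})h_{p'}(\mathbf{x})-\sum_{p\in\mathcal{N}}\Big(\mathbf{q}_p^T(\mathbf{x},\mathbf{y})\boldsymbol{\Lambda}_p^T(\mathbf{x})\mathbf{y}_p^2+r_p(\mathbf{x},\mathbf{y})\big(\boldsymbol{\xi}_p^T(\mathbf{x})\mathbf{y}_p^2+1\big)\Big)$$ is SOS, $s_p(\mathbf{x},\mathbf{y})$ is SOS for all $p\in\mathcal{N}$, and $s_{p'}(\mathbf{x},\mathbf{y})$ is SOS for all $p'\in\mathcal{P}\setminus\mathcal{N}$. Here $\mathbf{y}$ is the vector of variables obtained by concatenating all $\mathbf{y}_p$, $p\in\mathcal{N}$. Then for every $\mathbf{x}\in\mathcal{X}'_{\mathcal{N}}$ there exist $p\in\mathcal{N}$ and $\mathbf{u}\in\mathbb{R}^{n_u}$ such that $\boldsymbol{\Lambda}_p(\mathbf{x})\mathbf{u}\l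e\boldsymbol{\xi}_p(\mathbf{x})$.
   Context: $\mathbf{f}$ and $\mathbf{G}$ are polynomial in $\mathbf{x}\in\mathbb{R}^{n_x}$ (values in $\mathbb{R}^{n_x}$ and $\mathbb{R}^{n_x\times n_u}$), from the control affine system $\dot{\mathbf{x}}=\mathbf{f}(\mathbf{x})+\mathbf{G}(\mathbf{x})\mathbf{u}$ with admissible control set $\mathcal{U}=\{\mathbf{u}\in\mathbb{R}^{n_u}\mid\mathbf{A}\mathbf{u}\le\mathbf{c}\}$, $\mathbf{A}$ and $\mathbf{c}$ a constant matrix and vector, $\mathcal{U}$ compact. $h_1,\dots,h_{N_h}$ are given polynomials, $\mathcal{P}=\{1,\dots,N_h\}$; $\kappa,\epsilon_{cbf},\epsilon_u>0$ are given constants. $L_{\mathbf{f}}h=\frac{\partial h}{\partial\mathbf{x}}\mathbf{f}$, $L_{\mathbf{G}}h=\frac{\partial h}{\partial\mathbf{x}}\mathbf{G}$. For $p\in\mathcal{P}$, $$\boldsymbol{\Lambda}_p(\mathbf{x})=\begin{bmatrix}-L_{\mathbf{G}}h_p(\mathbf{x})\\ \mathbf{A}\end{bmatrix},\qquad\boldsymbol{\xi}_p(\mathbf{x})=\begin{bmatrix}L_{\mathbf{f}}h_p(\mathbf{x})+\kappa h_p(\mathbf{x})-\epsilon_{cbf}\\ \mathbf{c}-\epsilon_u\end{bmatrix},$$ where $\mathbf{c}-\epsilon_u$ subtracts $\epsilon_u$ from every entry. Vector inequalities are elementwise; $\mathbf{y}_p$ is a real vector of the same length as $\boldsymbol{\xi}_p$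 and $\mathbf{y}_p^2$ is its elementwise square. For nonempty $\mathcal{N}\subseteq\mathcal{P}$, $\mathcal{X}_{\mathcal{N}}=\{\mathbf{x}\mid h_p(\mathbf{x})\ge0\ \forall p\in\mathcal{N};\ h_{p'}(\mathbf{x})<0\ \forall p'\in\mathcal{P}\setminus\mathcal{N}\}$ and $\mathcal{X}'_{\mathcal{N}}=\{\mathbf{x}\mid h_p(\mathbf{x})\ge0\ \forall p\in\mathcal{N};\ h_{p'}(\mathbf{x})\le0\ \forall p'\in\mathcal{P}\setminus\mathcal{N}\}$. $\mathcal{S}_{ne}$ is the collection of nonempty $\mathcal{N}\subseteq\mathcal{P}$ with $\mathcal{X}_{\mathcal{N}}\ne\emptyset$. A polynomial is SOS (sum of squares) if it equals $\sum_{i=1}^{N}p_i^2$ for some polynomials $p_1,\dots,p_N$. *)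

theory Defs
  imports "HOL-Analysis.Analysis"
begin

text \<open>
  Dimensions are finite index types: \<open>'n\<close> for the state, \<open>'u\<close> for the control input, \<open>'m\<close> for the
  rows of the matrix \<open>A\<close>, and \<open>'p\<close> for the index set of the polynomials \<open>h\<^sub>p\<close>. A vector or matrix
  with one row stacked on top of \<open>'m\<close> further rows is indexed by \<open>'m option\<close>, with \<open>None\<close> as the
  top row. Polynomials over the reals are represented by the functions they induce.
\<close>

definition gradient :: "(real^'n \<Rightarrow> real) \<Rightarrow> real^'n \<Rightarrow> real^'n" where
  "gradient h x = (\<chi> i. frechet_derivative h (at x) (axis i 1))"

definition lie_f :: "(real^'n \<Rightarrow> real^'n) \<Rightarrow> (real^'n \<Rightarrow> real) \<Rightarrow> real^'n \<Rightarrow> real" where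
  "lie_f f h x = gradient h x \<bullet> f x"

definition lie_G :: "(real^'n \<Rightarrow> real^'u^'n) \<Rightarrow> (real^'n \<Rightarrow> real) \<Rightarrow> real^'n \<Rightarrow> real^'u" where
  "lie_G G h x = gradient h x v* G x"

definition control_set :: "real^'u^'m \<Rightarrow> real^'m \<Rightarrow> (real^'u) set" where
  "control_set A c = {u. A *v u \<le> c}"

definition Lam ::
  "(real^'n \<Rightarrow> real^'u^'n) \<Rightarrow> real^'u^'m \<Rightarrow> (real^'n \<Rightarrow> real) \<Rightarrow> real^'n \<Rightarrow> real^'u^('m option)" where
  "Lam G A h x = (\<chi> i. case i of None \<Rightarrow> - lie_G G h x | Some j \<Rightarrow> A $ j)"

definition xi ::
  "(real^'n \<Rightarrow> real^'n) \<Rightarrow> real^'m \<Rightarrow> real \<Rightarrow> real \<Rightarrow> real \<Rightarrow> (real^'n \<Rightarrow> real) \<Rightarrow> real^'n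
    \<Rightarrow> real^('m option)" where
  "xi f c \<kappa> \<epsilon>_cbf \<epsilon>_u h x =
     (\<chi> i. case i of None \<Rightarrow> lie_f f h x + \<kappa> * h x - \<epsilon>_cbf | Some j \<Rightarrow> c $ j - \<epsilon>_u)"

definition vsq :: "real^'k \<Rightarrow> real^'k" where
  "vsq y = (\<chi> i. (y $ i)\<^sup>2)"

definition X_set :: "('p::finite \<Rightarrow> real^'n \<Rightarrow> real) \<Rightarrow> 'p set \<Rightarrow> (real^'n) set" where
  "X_set h N = {x. (\<forall>p\<in>N. h p x \<ge> 0) \<and> (\<forall>p\<in>-N. h p x < 0)}"

definition X_set' :: "('p::finite \<Rightarrow> real^'n \<Rightarrow> real) \<Rightarrow> 'p set \<Rightarrow> (real^'n) set" where
  "X_set' h N = {x. (\<forall>p\<in>N. h p x \<ge> 0) \<and> (\<forall>p\<in>-N. h p x \<le> 0)}"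

definition S_ne :: "('p::finite \<Rightarrow> real^'n \<Rightarrow> real) \<Rightarrow> 'p set set" where
  "S_ne h = {N. N \<noteq> {} \<and> X_set h N \<noteq> {}}"

text \<open>
  The vector \<open>y\<close> of the sum-of-squares program concatenates \<open>y\<^sub>p\<close> for \<open>p \<in> N\<close> only. As the number of
  its variables depends on the set \<open>N\<close>, it cannot be a type of its own; instead \<open>y\<close> has a block
  for every \<open>p\<close>, and the polynomials in \<open>x\<close> and \<open>y\<close> are those that do not involve the blocks outside
  \<open>N\<close>.
\<close>

definition polys_xy :: "'p::finite set \<Rightarrow> ((real^'n) \<times> (real^'k^'p) \<Rightarrow> real) set" where
  "polys_xy N = {g. real_polynomial_function g \<and>
     (\<forall>x y y'. (\<forall>p\<in>N. y $ p = y' $ p) \<longrightarrow> g (x, y) = g (x, y'))}"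

definition sos_in :: "('a \<Rightarrow> real) set \<Rightarrow> ('a \<Rightarrow> real) \<Rightarrow> bool" where
  "sos_in R g \<longleftrightarrow> (\<exists>(k::nat) w. (\<forall>i\<in>{1..k}. w i \<in> R) \<and> g = (\<lambda>z. \<Sum>i=1..k. (w i z)\<^sup>2))"

end

theory Submission
  imports Defs
begin

text \<open>
  The program is a Positivstellensatz refutation, and its soundness is elementary. Suppose that at
  some \<open>x\<close> with the given sign pattern no system \<open>\<Lambda>\<^sub>p(x) u \<le> \<xi>\<^sub>p(x)\<close>, \<open>p \<in> N\<close>, is solvable. Farkas'
  lemma (\<open>farkas_certificate\<close>) turns the failure of each system into some \<open>v\<^sub>p \<ge> 0\<close> with
  \<open>\<Lambda>\<^sub>p(x)\<^sup>T v\<^sub>p = 0\<close> and \<open>\<xi>\<^sub>p(x)\<^sup>T v\<^sub>p = -1\<close>. Being nonnegative, \<open>v\<^sub>p\<close> is the elementwise square of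
  some \<open>y\<^sub>p\<close>; this is why the program can encode the sign condition on \<open>v\<^sub>p\<close> by using \<open>y\<^sub>p\<^sup>2\<close> in its
  place. At the point \<open>(x, y)\<close> the factors \<open>\<Lambda>\<^sub>p\<^sup>T y\<^sub>p\<^sup>2\<close> and \<open>\<xi>\<^sub>p\<^sup>T y\<^sub>p\<^sup>2 + 1\<close> vanish, which removes the
  multipliers \<open>q\<^sub>p\<close> and \<open>r\<^sub>p\<close> of unknown sign, and the signs of the \<open>h\<^sub>p(x)\<close> make the contributions
  \<open>- s\<^sub>p h\<^sub>p\<close> for \<open>p \<in> N\<close> and \<open>s\<^sub>p h\<^sub>p\<close> for \<open>p \<notin> N\<close> nonpositive. The value of the expression there is
  at most \<open>-1\<close>, which is impossible for a sum of squares.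
\<close>

text \<open>
  The right-hand sides \<open>v\<close> for which \<open>M u \<le> v\<close> is solvable form a convex cone \<open>T\<close>. It contains the
  cone \<open>C\<close> generated by the columns of \<open>M\<close>, their negatives and the standard basis vectors. As
  \<open>C\<close> is finitely generated, it is closed, so that a hyperplane strictly
  separates it from an infeasible \<open>b\<close>. The normal of the hyperplane is nonnegative on the generators:
  on the basis vectors this says that the normal is nonnegative, and on the columns and their
  negatives that it is orthogonal to the columns. It only remains to rescale it.
\<close>

lemma farkas_certificate:
  fixes M :: "real^'u^'k" and b :: "real^'k"
  assumes infeasible: "\<nexists>u. M *v u \<le> b"
  obtains v where "0 \<le> v" "transpose M *v v = 0" "b \<bullet> v = - 1"
proof -
  define T where "T = {v. \<exists>u. M *v u \<le> v}"
  define S :: "(real^'k) set" where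
    "S = range (\<lambda>j. column j M) \<union> range (\<lambda>j. - column j M) \<union> range (\<lambda>i. axis i 1)"
  define C where "C = convex_cone hull S"
  have "convex_cone T"
    unfolding convex_cone_iff
  proof (intro conjI ballI allI impI)
    show "0 \<in> T"
      unfolding T_def by (auto intro!: exI[of _ 0])
  next
    fix v w assume "v \<in> T" "w \<in> T"
    then obtain u u' where "M *v u \<le> v" "M *v u' \<le> w"
      unfolding T_def by blast
    then have "M *v (u + u') \<le> v + w"
      by (simp add: matrix_vector_right_distrib less_eq_vec_def add_mono)
    then show "v + w \<in> T"
      unfolding T_def by blast
  next
    fix v and a :: real assume "v \<in> T" "0 \<le> a"
    then obtain u where "M *v u \<le> v"
      unfolding T_def by blast
    with \<open>0 \<le> a\<close> have "M *v (a *\<^sub>R u) \<le> a *\<^sub>R v"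
      by (simp add: matrix_vector_mult_scaleR less_eq_vec_def mult_left_mono)
    then show "a *\<^sub>R v \<in> T"
      unfolding T_def by blast
  qed
  moreover have "S \<subseteq> T"
  proof -
    have "column j M \<in> T" for j
      unfolding T_def by (auto intro!: exI[of _ "axis j 1"] simp: matrix_vector_mult_basis)
    moreover have "- column j M \<in> T" for j
      unfolding T_def
      by (auto intro!: exI[of _ "- axis j 1"] 
          simp: linear_neg[OF matrix_vector_mul_linear] matrix_vector_mult_basis)
    moreover have "axis i 1 \<in> T" for i
      unfolding T_def by (auto intro!: exI[of _ 0] simp: less_eq_vec_def axis_def)
    ultimately show ?thesis
      unfolding S_def by blast
  qed
  ultimately have "C \<subseteq> T"
    unfolding C_def by (simp add: hull_minimal)
  then have "b \<notin> C"
    using infeasible unfolding T_def by blast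
  moreover have "finite S"
    unfolding S_def by simp
  then have "closed C"
    unfolding C_def by (rule closed_convex_cone_hull)
  moreover have "convex C"
    unfolding C_def by (rule convex_convex_cone_hull)
  ultimately obtain a \<beta> where a: "a \<bullet> b < \<beta>" "\<And>v. v \<in> C \<Longrightarrow> \<beta> < a \<bullet> v"
    using separating_hyperplane_closed_point[of C b] by blast
  have "\<beta> < 0"
    using a(2)[of 0] convex_cone_hull_contains_0[of S] by (simp add: C_def)
  then have ab: "a \<bullet> b < 0"
    using a(1) by linarith
  have nonneg: "0 \<le> a \<bullet> v" if "v \<in> C" for v
  proof (rule ccontr)
    assume neg: "\<not> 0 \<le> a \<bullet> v"
    \<comment> \<open>The multiple of \<open>v\<close> on the separating hyperplane would lie in \<open>C\<close>.\<close>
    have "(\<beta> / (a \<bullet> v)) *\<^sub>R v \<in> C"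
      using that neg \<open>\<beta> < 0\<close> unfolding C_def
      by (intro convex_cone_hull_mul) (auto simp: divide_nonpos_neg)
    from a(2)[OF this] neg show False
      by simp
  qed
  have gen: "0 \<le> a \<bullet> v" if "v \<in> S" for v
    using nonneg that unfolding C_def by (simp add: hull_inc)
  have "0 \<le> a"
    using gen[of "axis _ 1"] by (auto simp: S_def less_eq_vec_def inner_axis)
  moreover have "transpose M *v a = 0"
  proof -
    have "a \<bullet> column j M = 0" for j
      using gen[of "column j M"] gen[of "- column j M"] by (auto simp: S_def)
    then show ?thesis
      by (simp add: vec_eq_iff vector_matrix_mult_def column_def inner_vec_def mult.commute)
  qed
  ultimately show ?thesis
  proof (intro that)
    define t where "t = - 1 / (a \<bullet> b)"
    have "0 \<le> t"
      using ab by (simp add: t_def divide_nonneg_neg)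
    show "0 \<le> t *\<^sub>R a" if "0 \<le> a"
      using that \<open>0 \<le> t\<close> by (simp add: less_eq_vec_def)
    show "transpose M *v (t *\<^sub>R a) = 0" if "transpose M *v a = 0"
      by (simp only: matrix_vector_mult_scaleR that scaleR_zero_right)
    show "b \<bullet> (t *\<^sub>R a) = - 1"
      using ab by (simp add: t_def inner_commute)
  qed
qed

lemma sos_in_nonneg:
  assumes "sos_in R g"
  shows "0 \<le> g z"
  using assms unfolding sos_in_def by (auto intro: sum_nonneg)

theorem theorem4:
  fixes f :: "real^'n \<Rightarrow> real^'n"
    and G :: "real^'n \<Rightarrow> real^'u^'n"
    and A :: "real^'u^'m"
    and c :: "real^'m"
    and h :: "'p::finite \<Rightarrow> real^'n \<Rightarrow> real"
    and \<kappa> \<epsilon>_cbf \<epsilon>_u :: real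
    and N :: "'p set"
  assumes "polynomial_function f"
    and "polynomial_function G"
    and "\<And>p. real_polynomial_function (h p)"
    and "compact (control_set A c)"
    and "\<kappa> > 0" and "\<epsilon>_cbf > 0" and "\<epsilon>_u > 0"
    and "N \<in> S_ne h"
    and "\<exists>(s :: 'p \<Rightarrow> (real^'n) \<times> (real^('m option)^'p) \<Rightarrow> real)
            (r :: 'p \<Rightarrow> (real^'n) \<times> (real^('m option)^'p) \<Rightarrow> real)
            (q :: 'p \<Rightarrow> (real^'n) \<times> (real^('m option)^'p) \<Rightarrow> real^'u).
          (\<forall>p. s p \<in> polys_xy N) \<and>
          (\<forall>p\<in>N. r p \<in> polys_xy N) \<and>
          (\<forall>p\<in>N. \<forall>j. (\<lambda>z. q p z $ j) \<in> polys_xy N) \<and>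
          sos_in (polys_xy N)
            (\<lambda>(x, y). - 1 - (\<Sum>p\<in>N. s p (x, y) * h p x)
               + (\<Sum>p'\<in>-N. s p' (x, y) * h p' x)
               - (\<Sum>p\<in>N. q p (x, y) \<bullet> (transpose (Lam G A (h p) x) *v vsq (y $ p))
                    + r p (x, y) * (xi f c \<kappa> \<epsilon>_cbf \<epsilon>_u (h p) x \<bullet> vsq (y $ p) + 1))) \<and>
          (\<forall>p\<in>N. sos_in (polys_xy N) (s p)) \<and>
          (\<forall>p'\<in>-N. sos_in (polys_xy N) (s p'))"
  shows "\<forall>x\<in>X_set' h N. \<exists>p\<in>N. \<exists>u :: real^'u.
           Lam G A (h p) x *v u \<le> xi f c \<kappa> \<epsilon>_cbf \<epsilon>_u (h p) x"
proof (intro ballI, rule ccontr)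
  fix x assume x: "x \<in> X_set' h N"
  assume "\<not> (\<exists>p\<in>N. \<exists>u :: real^'u. Lam G A (h p) x *v u \<le> xi f c \<kappa> \<epsilon>_cbf \<epsilon>_u (h p) x)"
  then have "\<forall>p\<in>N. \<exists>v. 0 \<le> v \<and> transpose (Lam G A (h p) x) *v v = 0
      \<and> xi f c \<kappa> \<epsilon>_cbf \<epsilon>_u (h p) x \<bullet> v = - 1"
    by (metis farkas_certificate)
  then obtain v where v: "\<And>p. p \<in> N \<Longrightarrow> 0 \<le> v p"
      "\<And>p. p \<in> N \<Longrightarrow> transpose (Lam G A (h p) x) *v v p = 0"
      "\<And>p. p \<in> N \<Longrightarrow> xi f c \<kappa> \<epsilon>_cbf \<epsilon>_u (h p) x \<bullet> v p = - 1"
    by metis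
  define y :: "real^('m option)^'p" where "y = (\<chi> p i. sqrt (v p $ i))"
  have y: "vsq (y $ p) = v p" if "p \<in> N" for p
    using v(1)[OF that] by (simp add: vsq_def y_def vec_eq_iff less_eq_vec_def)
  obtain s r q where
    sos: "sos_in (polys_xy N)
            (\<lambda>(x, y :: real^('m option)^'p). - 1 - (\<Sum>p\<in>N. s p (x, y) * h p x)
               + (\<Sum>p'\<in>-N. s p' (x, y) * h p' x)
               - (\<Sum>p\<in>N. q p (x, y) \<bullet> (transpose (Lam G A (h p) x) *v vsq (y $ p))
                    + r p (x, y) * (xi f c \<kappa> \<epsilon>_cbf \<epsilon>_u (h p) x \<bullet> vsq (y $ p) + 1)))"
    and s: "\<forall>p\<in>N. sos_in (polys_xy N) (s p)" "\<forall>p'\<in>-N. sos_in (polys_xy N) (s p')"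
    using assms(9) by blast
  have s_nonneg: "0 \<le> s p z" if "p \<in> N" for p z
    using s(1) that by (blast intro: sos_in_nonneg)
  have s_nonneg': "0 \<le> s p z" if "p \<notin> N" for p z
    using s(2) that by (blast intro: sos_in_nonneg)
  have "0 \<le> (\<Sum>p\<in>N. s p (x, y) * h p x)"
    using x s_nonneg by (intro sum_nonneg mult_nonneg_nonneg) (auto simp: X_set'_def)
  moreover have "(\<Sum>p'\<in>-N. s p' (x, y) * h p' x) \<le> 0"
    using x s_nonneg' by (intro sum_nonpos mult_nonneg_nonpos) (auto simp: X_set'_def)
  moreover have "(\<Sum>p\<in>N. q p (x, y) \<bullet> (transpose (Lam G A (h p) x) *v vsq (y $ p))
      + r p (x, y) * (xi f c \<kappa> \<epsilon>_cbf \<epsilon>_u (h p) x \<bullet> vsq (y $ p) + 1)) = 0"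
    by (intro sum.neutral ballI) (simp add: y v del: transpose_matrix_vector)
  ultimately show False
    using sos_in_nonneg[OF sos, of "(x, y)"] by simp
qed

end
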